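(* Let $I$ be a finite set, let $g_\alpha:\mathbb{Z}_+\to\mathbb{R}_+$ be given for each $\alpha\in I$, and let $\mathbf{w}=(w(\alpha))_{\alpha\in I}$ be a weight function with values in $\mathbb{R}^d$ for some $d\ge 1$. Let $t\in\mathbb{R}^d$ be such that there exists a normalizing constant $f(I,t)$ for which the formula $$\mathbb{P}(\mathbf{C}_I=\mathbf{a})=\mathbf{1}(\mathbf{w}\cdot\mathbf{a}=t)\, f(I,t)\prod_{\alpha\in I} g_\alpha(a_\alpha),\qquad \mathbf{a}\in\mathbb{Z}_+^I,$$ defines a probability distribution on $\mathbb{Z}_+^I$, and let $\mathbf{C}_I=(C_\alpha)_{\alpha\in I}$ be a $\mathbb{Z}_+^I$-valued random element with this distribution. Let $x\in(0,\infty)^d$ be such that there exist normalizing constants $c_\alpha(x)\in(0,\infty)$, $\alpha\in I$, for which $$\mathbb{P}(Z_\alpha=k)=c_\alpha(x)\,g_\alpha(k)\,x^{w(\alpha)k},\qquad k=0,1,2,\ldots$$ defines a probability distribution on $\mathbb{Z}_+$ for each $\alpha\in I$. Let $\mathbf{Z}_I=(Z_\alpha)_{\alpha\in I}$ have independent coordinates with these distributions, and let $T=\sum_{\alpha\in I}w(\alpha)Z_\alpha$. Then $$\mathbf{C}_I\stackrel{d}{=}(\mathbf{Z}_I\mid T=t),$$ and hence for any $B\subset I$, the processes restricted to indices in $B$ satisfy $$\mathbf{C}_B\stackrel{d}{=}(\mathbf{Z}_B\mid T=t).$$ Furthermore, $$\mathbb{P}(T=t)=f(I,t)^{-1}\,x^t\prod_{\alpha\in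 I}c_\alpha(x).$$
   Context: $\mathbb{Z}_+=\{0,1,2,\ldots\}$, $\mathbb{R}_+=[0,\infty)$. For $\mathbf{a}\in\mathbb{Z}_+^I$ with coordinates $a_\alpha=a(\alpha)$, $\mathbf{w}\cdot\mathbf{a}=\sum_{\alpha\in I}a(\alpha)w(\alpha)$. For $x=(x_1,\ldots,x_d)\in(0,\infty)^d$ and $v=(v_1,\ldots,v_d)\in\mathbb{R}^d$, $x^{v}$ denotes $x_1^{v_1}\cdots x_d^{v_d}$; thus $x^{w(\alpha)k}=x_1^{w_1(\alpha)k}\cdots x_d^{w_d(\alpha)k}$. $\mathbf{1}(\cdot)$ is the indicator, $\stackrel{d}{=}$ denotes equality in distribution, $(\mathbf{Z}\mid T=t)$ denotes the conditional distribution given the event $\{T=t\}$, and for $B\subset I$, $\mathbf{C}_B=(C_\alpha)_{\alpha\in B}$, $\mathbf{Z}_B=(Z_\alpha)_{\alpha\in B}$. *)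

theory Defs
  imports "HOL-Probability.Probability"
begin

definition vec_powr :: "real ^ 'd \<Rightarrow> real ^ 'd \<Rightarrow> real" where
  "vec_powr x v = (\<Prod>j\<in>UNIV. (x $ j) powr (v $ j))"

definition weight_sum :: "'i set \<Rightarrow> ('i \<Rightarrow> real ^ 'd) \<Rightarrow> ('i \<Rightarrow> nat) \<Rightarrow> real ^ 'd" where
  "weight_sum I w a = (\<Sum>\<alpha>\<in>I. real (a \<alpha>) *\<^sub>R w \<alpha>)"

definition proc :: "'i set \<Rightarrow> ('i \<Rightarrow> 'm \<Rightarrow> nat) \<Rightarrow> 'm \<Rightarrow> 'i \<Rightarrow> nat" where
  "proc B X \<omega> = (\<lambda>\<alpha>\<in>B. X \<alpha> \<omega>)"

text \<open>For finite \<open>B\<close>, every subset of \<open>B \<rightarrow>\<^sub>E UNIV\<close> is measurable in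
  the product space below, so laws on it are arbitrary discrete laws.\<close>

definition proc_law :: "'m measure \<Rightarrow> 'i set \<Rightarrow> ('i \<Rightarrow> 'm \<Rightarrow> nat) \<Rightarrow> ('i \<Rightarrow> nat) measure" where
  "proc_law M B X = distr M (\<Pi>\<^sub>M \<alpha>\<in>B. count_space UNIV) (proc B X)"

text \<open>\<open>uniform_measure M A\<close> is the measure sending \<open>E\<close> to \<open>M (A \<inter> E) / M A\<close>; it is the
  conditional probability given \<open>A\<close> only when \<open>A\<close> has positive probability.\<close>

definition cond_proc_law ::
  "'m measure \<Rightarrow> ('m \<Rightarrow> bool) \<Rightarrow> 'i set \<Rightarrow> ('i \<Rightarrow> 'm \<Rightarrow> nat) \<Rightarrow> ('i \<Rightarrow> nat) measure" where
  "cond_proc_law M P B X = proc_law (uniform_measure M {\<omega> \<in> space M. P \<omega>}) B X"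

end

(* On the event T = t the tilting factors x^(w(alpha) a(alpha)) multiply to the constant x^t, so
   P(Z = a, T = t) = K P(C = a) for every a, with K = f(I,t)^-1 x^t prod_alpha c_alpha(x).
   Summing over the countably many a gives P(T = t) = K, and dividing by K gives the conditional
   law. Since the law of C has total mass 1, f(I,t) cannot be 0 or negative, so K > 0. *)
theory Submission
  imports Defs
begin

lemma vec_powr_pos:
  assumes "\<And>j. x $ j > 0"
  shows "vec_powr x v > 0"
proof -
  have "x $ j \<noteq> 0" for j using assms[of j] by simp
  then show ?thesis unfolding vec_powr_def by (intro prod_pos) simp
qed

text \<open>The exponent law holds in each coordinate, and exchanging two finite products collects
  the factors by index. Positivity keeps every base away from 0, where \<open>0 powr 0 = 0\<close>
  would break the law. This is how the tilting factors of the separate coordinates merge into one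
  power.\<close>

lemma vec_powr_sum:
  assumes "\<And>j. x $ j > 0" and "finite A"
  shows "vec_powr x (\<Sum>\<alpha>\<in>A. v \<alpha>) = (\<Prod>\<alpha>\<in>A. vec_powr x (v \<alpha>))"
proof -
  have "x $ j \<noteq> 0" for j using assms(1)[of j] by simp
  then have "vec_powr x (\<Sum>\<alpha>\<in>A. v \<alpha>) = (\<Prod>j\<in>UNIV. \<Prod>\<alpha>\<in>A. (x $ j) powr (v \<alpha> $ j))"
    unfolding vec_powr_def by (simp add: sum_component powr_sum assms(2))
  also have "\<dots> = (\<Prod>\<alpha>\<in>A. vec_powr x (v \<alpha>))"
    unfolding vec_powr_def by (rule prod.swap)
  finally show ?thesis .
qed

lemma proc_measurable:
  assumes "\<And>\<alpha>. \<alpha> \<in> B \<Longrightarrow> X \<alpha> \<in> measurable M (count_space UNIV)"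
  shows "proc B X \<in> measurable M (\<Pi>\<^sub>M \<alpha>\<in>B. count_space UNIV)"
  unfolding proc_def using assms by (intro measurable_restrict)

text \<open>A finite product of discrete countable spaces is again discrete. Hence laws of processes
  on a finite index set may be compared point by point.\<close>

lemma sets_proc_law:
  assumes "finite B"
  shows "sets (proc_law M B X) = Pow (B \<rightarrow>\<^sub>E UNIV)"
  using assms by (simp add: proc_law_def count_space_PiM_finite)

lemma emeasure_proc_law:
  assumes "finite B" "\<And>\<alpha>. \<alpha> \<in> B \<Longrightarrow> X \<alpha> \<in> measurable M (count_space UNIV)"
    and "E \<subseteq> B \<rightarrow>\<^sub>E UNIV"
  shows "emeasure (proc_law M B X) E = emeasure M {\<omega> \<in> space M. proc B X \<omega> \<in> E}"
proof -
  have "E \<in> sets (\<Pi>\<^sub>M \<alpha>\<in>B. count_space (UNIV :: nat set))"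
    using assms(1,3) by (simp add: count_space_PiM_finite)
  then show ?thesis
    unfolding proc_law_def using assms(2)
    by (subst emeasure_distr) (auto intro!: proc_measurable arg_cong[where f = "emeasure M"])
qed

text \<open>Marginals are images under coordinate restriction, so an equality of laws on
  \<open>I\<close> passes to every subset. \<open>M\<close> is an arbitrary measure here, which lets
  the lemma serve the conditioned measure too.\<close>

lemma proc_law_restrict:
  assumes "B \<subseteq> I" "\<And>\<alpha>. \<alpha> \<in> I \<Longrightarrow> X \<alpha> \<in> measurable M (count_space UNIV)"
  shows "proc_law M B X =
    distr (proc_law M I X) (\<Pi>\<^sub>M \<alpha>\<in>B. count_space UNIV) (\<lambda>a. restrict a B)"
proof -
  have "(\<lambda>a. restrict a B) \<circ> proc I X = proc B X"
    using assms(1) by (auto simp: proc_def fun_eq_iff restrict_def)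
  then show ?thesis
    unfolding proc_law_def using assms
    by (subst distr_distr) (auto intro!: proc_measurable measurable_restrict_subset)
qed

text \<open>Both total masses are sums over the countably many points, and the constant factors out
  of the sum. It is used once with factor 0, to exclude a null law, and once to compute the
  probability of the conditioning event.\<close>

lemma emeasure_proportional:
  assumes "countable S" "sets P = Pow S" "sets Q = Pow S"
    and "\<And>a. a \<in> S \<Longrightarrow> emeasure Q {a} = K * emeasure P {a}"
  shows "emeasure Q S = K * emeasure P S"
proof -
  have "emeasure Q S = (\<integral>\<^sup>+ a. emeasure Q {a} \<partial>count_space S)"
    using assms by (intro emeasure_countable_singleton) auto
  also have "\<dots> = (\<integral>\<^sup>+ a. K * emeasure P {a} \<partial>count_space S)"
    using assms(4) by (intro nn_integral_cong) simp
  also have "\<dots> = K * (\<integral>\<^sup>+ a. emeasure P {a} \<partial>count_space S)"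
    by (intro nn_integral_cmult) simp
  also have "(\<integral>\<^sup>+ a. emeasure P {a} \<partial>count_space S) = emeasure P S"
    using assms by (intro emeasure_countable_singleton[symmetric]) auto
  finally show ?thesis .
qed

lemma prob_proc_indep:
  assumes "prob_space N" "finite I"
    and "prob_space.indep_vars N (\<lambda>_. count_space UNIV) Z I"
    and "a \<in> I \<rightarrow>\<^sub>E UNIV"
  shows "\<P>(\<omega> in N. proc I Z \<omega> = a) = (\<Prod>\<alpha>\<in>I. \<P>(\<omega> in N. Z \<alpha> \<omega> = a \<alpha>))"
\<comment> \<open>\<open>indep_varsD\<close> needs a nonempty index set. For the empty one, the
  process has a single possible value, and the empty product is 1.\<close>
proof (cases "I = {}")
  case True
  then have "proc I Z \<omega> = a" for \<omega>
    using assms(4) by (auto simp: proc_def)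
  then show ?thesis
    using True assms(1) by (simp add: prob_space.prob_space)
next
  case False
  interpret N: prob_space N by fact
  have "proc I Z \<omega> = a \<longleftrightarrow> (\<forall>\<alpha>\<in>I. Z \<alpha> \<omega> = a \<alpha>)" for \<omega>
    using assms(4) by (auto simp: proc_def fun_eq_iff PiE_def extensional_def)
  then have "{\<omega> \<in> space N. proc I Z \<omega> = a} = (\<Inter>\<alpha>\<in>I. Z \<alpha> -` {a \<alpha>} \<inter> space N)"
    using False by auto
  then have "\<P>(\<omega> in N. proc I Z \<omega> = a) = (\<Prod>\<alpha>\<in>I. N.prob (Z \<alpha> -` {a \<alpha>} \<inter> space N))"
    using N.indep_varsD[OF assms(3) False assms(2) subset_refl, of "\<lambda>\<alpha>. {a \<alpha>}"] by simp
  then show ?thesis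
    by (simp add: vimage_def Int_def conj_commute)
qed

theorem theorem1:
  fixes I :: "'i set"
    and g :: "'i \<Rightarrow> nat \<Rightarrow> real"
    and w :: "'i \<Rightarrow> real ^ 'd"
    and t x :: "real ^ 'd"
    and f :: "'i set \<Rightarrow> real ^ 'd \<Rightarrow> real"
    and c :: "'i \<Rightarrow> real ^ 'd \<Rightarrow> real"
    and M :: "'m measure" and C :: "'i \<Rightarrow> 'm \<Rightarrow> nat"
    and N :: "'n measure" and Z :: "'i \<Rightarrow> 'n \<Rightarrow> nat"
    and T :: "'n \<Rightarrow> real ^ 'd"
  assumes "finite I"
    and "\<And>\<alpha> k. \<alpha> \<in> I \<Longrightarrow> g \<alpha> k \<ge> 0"
    and "prob_space M"
    and "\<And>\<alpha>. \<alpha> \<in> I \<Longrightarrow> C \<alpha> \<in> measurable M (count_space UNIV)"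
    and "\<And>a. a \<in> I \<rightarrow>\<^sub>E UNIV \<Longrightarrow>
           \<P>(\<omega> in M. proc I C \<omega> = a)
             = of_bool (weight_sum I w a = t) * f I t * (\<Prod>\<alpha>\<in>I. g \<alpha> (a \<alpha>))"
    and "\<And>j. x $ j > 0"
    and "\<And>\<alpha>. \<alpha> \<in> I \<Longrightarrow> c \<alpha> x > 0"
    and "prob_space N"
    and "prob_space.indep_vars N (\<lambda>_. count_space UNIV) Z I"
    and "\<And>\<alpha> k. \<alpha> \<in> I \<Longrightarrow>
           \<P>(\<omega> in N. Z \<alpha> \<omega> = k) = c \<alpha> x * g \<alpha> k * vec_powr x (real k *\<^sub>R w \<alpha>)"
    and "\<And>\<omega>. T \<omega> = (\<Sum>\<alpha>\<in>I. real (Z \<alpha> \<omega>) *\<^sub>R w \<alpha>)"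
  shows "\<P>(\<omega> in N. T \<omega> = t) > 0
    \<and> proc_law M I C = cond_proc_law N (\<lambda>\<omega>. T \<omega> = t) I Z
    \<and> (\<forall>B\<subseteq>I. proc_law M B C = cond_proc_law N (\<lambda>\<omega>. T \<omega> = t) B Z)
    \<and> \<P>(\<omega> in N. T \<omega> = t) = inverse (f I t) * vec_powr x t * (\<Prod>\<alpha>\<in>I. c \<alpha> x)"
proof -
  note finI = assms(1) and g = assms(2) and C = assms(4) and PC = assms(5)
    and xpos = assms(6) and cpos = assms(7) and indep = assms(9) and PZ = assms(10)
    and T = assms(11)
  interpret M: prob_space M by fact
  interpret N: prob_space N by fact
  have Z: "Z \<alpha> \<in> measurable N (count_space UNIV)" if "\<alpha> \<in> I" for \<alpha>
    using indep that by (auto simp: N.indep_vars_def)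
  define S where "S = I \<rightarrow>\<^sub>E (UNIV :: nat set)"
  have S: "countable S"
    unfolding S_def by (intro countable_PiE finI) auto
  have procS: "proc I X \<omega> \<in> S" for X :: "'i \<Rightarrow> 'z \<Rightarrow> nat" and \<omega>
    by (auto simp: S_def proc_def)

  define A where "A = {\<omega> \<in> space N. T \<omega> = t}"
  define K where "K = inverse (f I t) * vec_powr x t * (\<Prod>\<alpha>\<in>I. c \<alpha> x)"
  define \<mu> where "\<mu> = proc_law M I C"
  \<comment> \<open>The law of \<open>Z\<close> on the event \<open>A\<close>, left unnormalized:
    its total mass is the probability to be found, so nothing is divided by it before it is known to
    be positive.\<close>
  define \<nu> where "\<nu> = proc_law (density N (indicator A)) I Z"

  \<comment> \<open>\<open>T\<close> depends on the outcome only through the discrete process, so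
    measurability of \<open>A\<close> comes from that of the \<open>Z \<alpha>\<close>.\<close>
  have T_proc: "T \<omega> = weight_sum I w (proc I Z \<omega>)" for \<omega>
    by (simp add: T weight_sum_def proc_def)
  have Z_event: "{\<omega> \<in> space N. proc I Z \<omega> \<in> E} \<in> sets N" if "E \<subseteq> S" for E
  proof -
    have "E \<in> sets (\<Pi>\<^sub>M \<alpha>\<in>I. count_space (UNIV :: nat set))"
      using that finI by (simp add: S_def count_space_PiM_finite)
    from measurable_sets[OF proc_measurable[OF Z] this] show ?thesis
      by (simp add: vimage_def Int_def conj_commute)
  qed
  have A: "A \<in> sets N"
    using Z_event[of "{a \<in> S. weight_sum I w a = t}"]
    by (simp add: A_def T_proc procS)

  have mu_sets: "sets \<mu> = Pow S" and nu_sets: "sets \<nu> = Pow S"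
    by (simp_all add: \<mu>_def \<nu>_def S_def sets_proc_law finI)
  have mu_single: "emeasure \<mu> {a} = ennreal (\<P>(\<omega> in M. proc I C \<omega> = a))" if "a \<in> S" for a
    using that by (simp add: \<mu>_def S_def emeasure_proc_law finI C M.emeasure_eq_measure)
  have mu_S: "emeasure \<mu> S = 1"
    using procS[of C] by (simp add: \<mu>_def S_def emeasure_proc_law finI C M.emeasure_space_1)
  have nu_S: "emeasure \<nu> S = emeasure N A"
    using procS[of Z] A
    by (simp add: \<nu>_def S_def emeasure_proc_law finI Z emeasure_restricted)

  have fpos: "f I t > 0"
  proof -
    \<comment> \<open>Some point must be charged: if all singletons were null, \<open>\<mu>\<close>
      would be proportional to itself with factor 0, contradicting total mass 1.\<close>
    obtain a where a: "a \<in> S" "emeasure \<mu> {a} \<noteq> 0"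
    proof (rule ccontr)
      assume "\<not> thesis"
      with that have "emeasure \<mu> {a} = 0 * emeasure \<mu> {a}" if "a \<in> S" for a
        using that by auto
      from emeasure_proportional[OF S mu_sets mu_sets this] mu_S show False by simp
    qed
    then have "\<P>(\<omega> in M. proc I C \<omega> = a) > 0"
      using mu_single by (simp add: zero_less_measure_iff M.emeasure_eq_measure)
    then have "of_bool (weight_sum I w a = t) * f I t * (\<Prod>\<alpha>\<in>I. g \<alpha> (a \<alpha>)) > 0"
      using PC a(1) by (simp add: S_def)
    \<comment> \<open>At the charged point the product of all factors is positive; since the
      \<open>g\<close> factors are nonnegative, the sign must come from
      \<open>f I t\<close>.\<close>
    moreover have "(\<Prod>\<alpha>\<in>I. g \<alpha> (a \<alpha>)) \<ge> 0"
      using g by (intro prod_nonneg) auto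
    ultimately show ?thesis
      by (cases "weight_sum I w a = t") (auto simp: zero_less_mult_iff)
  qed
  have Kpos: "K > 0"
    unfolding K_def using fpos vec_powr_pos[OF xpos] cpos by (intro mult_pos_pos prod_pos) auto

  have joint: "\<P>(\<omega> in N. T \<omega> = t \<and> proc I Z \<omega> = a) = K * \<P>(\<omega> in M. proc I C \<omega> = a)"
    if a: "a \<in> S" for a
  proof (cases "weight_sum I w a = t")
    case False
    then have empty: "{\<omega> \<in> space N. T \<omega> = t \<and> proc I Z \<omega> = a} = {}"
      by (auto simp: T_proc)
    show ?thesis
      unfolding empty using False PC a by (simp add: S_def)
  next
    case True
    \<comment> \<open>Here \<open>proc I Z \<omega> = a\<close> already forces
      \<open>T \<omega> = t\<close>, so the joint event is a pure product event and independence
      applies.\<close>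
    then have "{\<omega> \<in> space N. T \<omega> = t \<and> proc I Z \<omega> = a} = {\<omega> \<in> space N. proc I Z \<omega> = a}"
      by (auto simp: T_proc)
    then have "\<P>(\<omega> in N. T \<omega> = t \<and> proc I Z \<omega> = a)
        = (\<Prod>\<alpha>\<in>I. c \<alpha> x * g \<alpha> (a \<alpha>) * vec_powr x (real (a \<alpha>) *\<^sub>R w \<alpha>))"
      using prob_proc_indep[OF \<open>prob_space N\<close> finI indep, of a] a PZ by (simp add: S_def)
    also have "\<dots> = (\<Prod>\<alpha>\<in>I. c \<alpha> x) * (\<Prod>\<alpha>\<in>I. g \<alpha> (a \<alpha>)) * vec_powr x t"
      using vec_powr_sum[OF xpos finI, of "\<lambda>\<alpha>. real (a \<alpha>) *\<^sub>R w \<alpha>"] True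
      by (simp add: prod.distrib weight_sum_def)
    \<comment> \<open>The factor \<open>inverse (f I t)\<close> in \<open>K\<close> cancels the
      \<open>f I t\<close> in the law of \<open>C\<close>; this uses \<open>fpos\<close>.\<close>
    also have "\<dots> = K * \<P>(\<omega> in M. proc I C \<omega> = a)"
      using True PC a fpos by (simp add: S_def K_def)
    finally show ?thesis .
  qed
  have joint_event: "A \<inter> {\<omega> \<in> space N. proc I Z \<omega> = a}
      = {\<omega> \<in> space N. T \<omega> = t \<and> proc I Z \<omega> = a}" for a
    by (auto simp: A_def)

  have "emeasure \<nu> {a} = ennreal K * emeasure \<mu> {a}" if a: "a \<in> S" for a
  proof -
    have "emeasure \<nu> {a} = emeasure N (A \<inter> {\<omega> \<in> space N. proc I Z \<omega> = a})"
      using a A Z_event[of "{a}"]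
      by (simp add: \<nu>_def S_def emeasure_proc_law finI Z emeasure_restricted)
    also have "\<dots> = ennreal (K * \<P>(\<omega> in M. proc I C \<omega> = a))"
      unfolding joint_event N.emeasure_eq_measure joint[OF a] ..
    also have "\<dots> = ennreal K * emeasure \<mu> {a}"
      using Kpos by (simp add: mu_single a ennreal_mult)
    finally show ?thesis .
  qed
  \<comment> \<open>Summed over \<open>S\<close>, the left side is the mass of \<open>A\<close>,
    while the law of \<open>C\<close> contributes 1, so only \<open>K\<close> remains.\<close>
  from emeasure_proportional[OF S mu_sets nu_sets this]
  have NA: "emeasure N A = ennreal K"
    by (simp add: mu_S nu_S)
  then have PT: "\<P>(\<omega> in N. T \<omega> = t) = K"
    using Kpos by (simp add: A_def measure_def)

  let ?U = "uniform_measure N A"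
  have ZU: "Z \<alpha> \<in> measurable ?U (count_space UNIV)" if "\<alpha> \<in> I" for \<alpha>
    using Z[OF that] by (simp add: measurable_def)
  have law_I: "proc_law M I C = cond_proc_law N (\<lambda>\<omega>. T \<omega> = t) I Z"
    unfolding cond_proc_law_def A_def[symmetric]
  \<comment> \<open>Both laws live on the power set of the countable set \<open>S\<close>, so
    agreement on singletons suffices.\<close>
  proof (rule measure_eqI_countable)
    show "sets (proc_law M I C) = Pow S" "sets (proc_law ?U I Z) = Pow S"
      by (simp_all add: S_def sets_proc_law finI)
    show "countable S" by fact
    fix a assume a: "a \<in> S"
    have "emeasure (proc_law ?U I Z) {a}
        = emeasure N (A \<inter> {\<omega> \<in> space N. proc I Z \<omega> = a}) / emeasure N A"
      using a A Z_event[of "{a}"]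
      by (simp add: emeasure_proc_law finI ZU S_def)
    also have "\<dots> = ennreal (K * \<P>(\<omega> in M. proc I C \<omega> = a)) / ennreal K"
      unfolding joint_event NA N.emeasure_eq_measure[of "{\<omega> \<in> space N. _ \<omega>}"] joint[OF a] ..
    \<comment> \<open>Cancelling \<open>ennreal K\<close> is sound because \<open>K\<close> is a
      positive real, hence neither 0 nor infinite.\<close>
    also have "\<dots> = ennreal (\<P>(\<omega> in M. proc I C \<omega> = a))"
      using Kpos by (simp add: divide_ennreal)
    finally show "emeasure (proc_law M I C) {a} = emeasure (proc_law ?U I Z) {a}"
      using mu_single[OF a] by (simp add: \<mu>_def)
  qed
  have "proc_law M B C = cond_proc_law N (\<lambda>\<omega>. T \<omega> = t) B Z" if "B \<subseteq> I" for B
    using law_I proc_law_restrict[OF that C] proc_law_restrict[OF that ZU]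
    by (simp add: cond_proc_law_def A_def)
  then show ?thesis
    using law_I PT Kpos by (simp add: K_def)
qed

end
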